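(* Let the Finsler space $(M,F)$, $\dim M=N\ge3$, be conformally automorphic to the Riemannian space $(M,S)$ with constant degree $H$ through the transformation $t=t(x,y)$, with inverse $y=y(x,t)$. Then the coefficients $$N^n{}_i=-y^n_h\left(\frac{\partial t^h}{\partial x^i}+a^h{}_{ki}t^k\right)$$ admit the representation $$N^n{}_i=d^{\rm Riem}_i y^n\equiv\frac{\partial y^n(x,t)}{\partial x^i}-y^n_h\,a^h{}_{ik}t^k ,$$ the right-hand side being evaluated at $t=t(x,y)$.
   Context: $M$ is a $C^\infty$ manifold with local coordinates $x^i$; $y^i$ are the induced coordinates of tangent vectors $y\in T_xM\setminus0$; repeated indices are summed over $1,\dots,N$; considerations are local. The Finsler metric function $F(x,y)$ is smooth, positive, positively homogeneous of degree 1 in $y$, with positive-definite $g_{ij}=\frac12\,\partial^2F^2/\partial y^i\partial y^j$. $S(x,y)=\sqrt{a_{ij}(x)y^iy^j}$ is a Riemannian metric function and $a^i{}_{kn}(x)$ are the Christoffel symbols of $a_{ij}$. Definition. $(M,F)$ is conformally automorphic to $(M,S)$, of degree $H>0$, if there is a smooth family of invertible smooth transformations $y\mapsto t=t(x,y)$ of nonzero tangent vectors at $x$ into nonzero tangent vectors at the same $x$ such that: (i) $t^m(x,ky)=k^{H}t^m(x,y)$ for all $k>0$; (ii) $F(x,y)=1\iff S(x,t(x,y))=1$; (iii) $g_{mn}(x,y)=p^2\,a_{ij}(x)\,t^i_m t^j_n$, where $t^i_m=\partial t^i/\partial y^m$ and $p=p(x,y)>0$. Notation: $y^n_h=\partial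 y^n(x,t)/\partial t^h$; $d^{\rm Riem}_i=\frac{\partial}{\partial x^i}-a^k{}_{ih}t^h\frac{\partial}{\partial t^k}$ acts on functions of $(x,t)$. *)

theory Defs
  imports "HOL-Analysis.Analysis"
begin

text \<open>
  Everything is expressed in a local chart: the chart domain is an open set \<open>U\<close> of
  \<^typ>\<open>real ^ 'n\<close>, and the tangent space at each point of \<open>U\<close> is identified with
  \<^typ>\<open>real ^ 'n\<close> through the coordinate frame. A function on the slit tangent bundle is a
  curried function of the base point and the tangent vector; its values at the zero vector and
  at base points outside \<open>U\<close> are irrelevant.
\<close>

text \<open>The notion \<open>C_on k S f\<close> is meant for open \<open>S\<close>, where it is the usual class of \<open>k\<close> times
  continuously differentiable functions.\<close>

primrec C_on :: "nat \<Rightarrow> 'a::euclidean_space set \<Rightarrow> ('a \<Rightarrow> 'b::real_normed_vector) \<Rightarrow> bool" where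
  "C_on 0 S f \<longleftrightarrow> continuous_on S f"
| "C_on (Suc k) S f \<longleftrightarrow>
     (\<forall>x\<in>S. f differentiable (at x)) \<and>
     (\<forall>v. C_on k S (\<lambda>x. frechet_derivative f (at x) v))"

definition smooth_on :: "'a::euclidean_space set \<Rightarrow> ('a \<Rightarrow> 'b::real_normed_vector) \<Rightarrow> bool" where
  "smooth_on S f \<longleftrightarrow> (\<forall>k. C_on k S f)"

definition partial :: "'n::finite \<Rightarrow> (real ^ 'n \<Rightarrow> real) \<Rightarrow> real ^ 'n \<Rightarrow> real" where
  "partial i f x = deriv (\<lambda>s. f (x + s *\<^sub>R axis i 1)) 0"

definition positive_definite :: "real ^ 'n ^ 'n \<Rightarrow> bool" where
  "positive_definite A \<longleftrightarrow> (\<forall>v. v \<noteq> 0 \<longrightarrow> (\<Sum>i\<in>UNIV. \<Sum>j\<in>UNIV. A $ i $ j * v $ i * v $ j) > 0)"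

definition finsler_tensor ::
  "(real ^ 'n \<Rightarrow> real ^ 'n \<Rightarrow> real) \<Rightarrow> real ^ 'n \<Rightarrow> real ^ 'n \<Rightarrow> real ^ 'n ^ 'n" where
  "finsler_tensor F x y =
     (\<chi> i j. 1/2 * partial i (\<lambda>v. partial j (\<lambda>w. (F x w)\<^sup>2) v) y)"

definition finsler_metric ::
  "(real ^ 'n) set \<Rightarrow> (real ^ 'n \<Rightarrow> real ^ 'n \<Rightarrow> real) \<Rightarrow> bool" where
  "finsler_metric U F \<longleftrightarrow>
     smooth_on (U \<times> (- {0})) (\<lambda>(x, y). F x y) \<and>
     (\<forall>x\<in>U. \<forall>y. y \<noteq> 0 \<longrightarrow>
        F x y > 0 \<and>
        (\<forall>k>0. F x (k *\<^sub>R y) = k * F x y) \<and>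
        positive_definite (finsler_tensor F x y))"

definition riemannian_metric :: "(real ^ 'n) set \<Rightarrow> (real ^ 'n \<Rightarrow> real ^ 'n ^ 'n) \<Rightarrow> bool" where
  "riemannian_metric U a \<longleftrightarrow>
     smooth_on U a \<and>
     (\<forall>x\<in>U. transpose (a x) = a x \<and> positive_definite (a x))"

definition riemannian_norm ::
  "(real ^ 'n \<Rightarrow> real ^ 'n ^ 'n) \<Rightarrow> real ^ 'n \<Rightarrow> real ^ 'n \<Rightarrow> real" where
  "riemannian_norm a x y = sqrt (\<Sum>i\<in>UNIV. \<Sum>j\<in>UNIV. a x $ i $ j * y $ i * y $ j)"

text \<open>\<open>christoffel a i k n x\<close> is $a^i{}_{kn}(x)$.\<close>

definition christoffel ::
  "(real ^ 'n \<Rightarrow> real ^ 'n ^ 'n) \<Rightarrow> 'n \<Rightarrow> 'n \<Rightarrow> 'n \<Rightarrow> real ^ 'n \<Rightarrow> real" where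
  "christoffel a i k n x =
     1/2 * (\<Sum>j\<in>UNIV. matrix_inv (a x) $ i $ j *
       (partial k (\<lambda>z. a z $ j $ n) x + partial n (\<lambda>z. a z $ j $ k) x
        - partial j (\<lambda>z. a z $ k $ n) x))"

text \<open>The family \<open>T\<close> stands for $t(x,y)$; \<open>partial m (\<lambda>v. T x v $ i) y\<close> is $t^i_m$.\<close>

definition conformally_automorphic_via ::
  "(real ^ 'n) set \<Rightarrow> (real ^ 'n \<Rightarrow> real ^ 'n \<Rightarrow> real) \<Rightarrow> (real ^ 'n \<Rightarrow> real ^ 'n ^ 'n) \<Rightarrow> real \<Rightarrow>
   (real ^ 'n \<Rightarrow> real ^ 'n \<Rightarrow> real ^ 'n) \<Rightarrow> bool" where
  "conformally_automorphic_via U F a H T \<longleftrightarrow>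
     H > 0 \<and>
     smooth_on (U \<times> (- {0})) (\<lambda>(x, y). T x y) \<and>
     (\<forall>x\<in>U. bij_betw (T x) (- {0}) (- {0})) \<and>
     (\<forall>x\<in>U. \<forall>y. y \<noteq> 0 \<longrightarrow>
        (\<forall>k>0. T x (k *\<^sub>R y) = (k powr H) *\<^sub>R T x y) \<and>
        (F x y = 1 \<longleftrightarrow> riemannian_norm a x (T x y) = 1)) \<and>
     (\<exists>p. \<forall>x\<in>U. \<forall>y. y \<noteq> 0 \<longrightarrow>
        p x y > (0::real) \<and>
        (\<forall>m n. finsler_tensor F x y $ m $ n =
           (p x y)\<^sup>2 * (\<Sum>i\<in>UNIV. \<Sum>j\<in>UNIV.
              a x $ i $ j * partial m (\<lambda>v. T x v $ i) y * partial n (\<lambda>v. T x v $ j) y)))"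

text \<open>\<open>connection_coeff a T Y n i x y\<close> is $N^n{}_i(x,y)$, where \<open>Y\<close> is the inverse $y(x,t)$
  of \<open>T\<close>, so that the derivatives $y^n_h$ are taken at $t = t(x,y)$.\<close>

definition connection_coeff ::
  "(real ^ 'n \<Rightarrow> real ^ 'n ^ 'n) \<Rightarrow> (real ^ 'n \<Rightarrow> real ^ 'n \<Rightarrow> real ^ 'n) \<Rightarrow>
   (real ^ 'n \<Rightarrow> real ^ 'n \<Rightarrow> real ^ 'n) \<Rightarrow> 'n \<Rightarrow> 'n \<Rightarrow> real ^ 'n \<Rightarrow> real ^ 'n \<Rightarrow> real" where
  "connection_coeff a T Y n i x y =
     - (\<Sum>h\<in>UNIV. partial h (\<lambda>t. Y x t $ n) (T x y) *
          (partial i (\<lambda>z. T z y $ h) x + (\<Sum>k\<in>UNIV. christoffel a h k i x * T x y $ k)))"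

definition d_Riem ::
  "(real ^ 'n \<Rightarrow> real ^ 'n ^ 'n) \<Rightarrow> 'n \<Rightarrow> (real ^ 'n \<Rightarrow> real ^ 'n \<Rightarrow> real) \<Rightarrow>
   real ^ 'n \<Rightarrow> real ^ 'n \<Rightarrow> real" where
  "d_Riem a i f x t =
     partial i (\<lambda>z. f z t) x
     - (\<Sum>k\<in>UNIV. \<Sum>h\<in>UNIV. christoffel a k i h x * t $ h * partial k (\<lambda>s. f x s) t)"

end

theory Submission
  imports Defs
begin

text \<open>
  The map \<open>(z, v) \<mapsto> (z, T z v)\<close> is continuous and injective, and its derivative is injective
  because the conformal relation (iii) pulls the positive definite \<open>g\<close> back from \<open>a\<close>. Hence its
  inverse \<open>(z, t) \<mapsto> (z, Y z t)\<close> is differentiable, and differentiating \<open>Y z (T z y) = y\<close> with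
  respect to \<open>z\<close> gives the claim, up to the symmetry of the Christoffel symbols.
\<close>

text \<open>\<open>partial\<close> is a one-variable \<open>deriv\<close>, which is meaningful only
  where a derivative exists. This lemma is the bridge to Frechet derivatives, where the chain rule
  and linearity are available.\<close>

lemma partial_eq_has_derivative:
  assumes "(f has_derivative f') (at x)"
  shows "partial i f x = f' (axis i 1)"
proof -
  interpret f': linear f'
    using assms by (rule has_derivative_linear)
  have "((\<lambda>s::real. x + s *\<^sub>R axis i 1) has_derivative (\<lambda>s. s *\<^sub>R axis i 1)) (at 0)"
    by (auto intro!: derivative_eq_intros)
  then have "((\<lambda>s. f (x + s *\<^sub>R axis i 1)) has_derivative (\<lambda>s. f' (s *\<^sub>R axis i 1))) (at 0)"
    by (rule has_derivative_compose) (simp add: assms)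
  then have "((\<lambda>s. f (x + s *\<^sub>R axis i 1)) has_field_derivative f' (axis i 1)) (at 0)"
    by (simp add: has_field_derivative_def f'.scaleR mult_commute_abs)
  then show ?thesis
    unfolding partial_def by (rule DERIV_imp_deriv)
qed

lemma partial_cong_open:
  assumes "open U" "x \<in> U" "\<And>z. z \<in> U \<Longrightarrow> f z = g z"
  shows "partial i f x = partial i g x"
proof -
  have "((\<lambda>s::real. x + s *\<^sub>R axis i 1) \<longlongrightarrow> x + 0 *\<^sub>R axis i 1) (nhds 0)"
    by (intro tendsto_intros filterlim_ident)
  then have "\<forall>\<^sub>F s in nhds 0. x + s *\<^sub>R axis i (1::real) \<in> U"
    using assms(1,2) by (simp add: tendsto_def)
  then have "\<forall>\<^sub>F s in nhds 0. f (x + s *\<^sub>R axis i 1) = g (x + s *\<^sub>R axis i 1)"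
    by eventually_elim (rule assms(3))
  then show ?thesis
    unfolding partial_def by (intro deriv_cong_ev refl)
qed

lemma linear_eq_sum_axis:
  fixes f :: "real ^ 'n \<Rightarrow> real"
  assumes "linear f"
  shows "f v = (\<Sum>h\<in>UNIV. f (axis h 1) * v $ h)"
proof -
  interpret linear f by fact
  have "f v = f (\<Sum>h\<in>UNIV. v $ h *\<^sub>R axis h 1)"
    by (simp add: basis_expansion flip: scalar_mult_eq_scaleR)
  then show ?thesis
    by (simp add: sum scaleR mult.commute)
qed

text \<open>Exchanging the lower indices swaps the first two partial derivatives and leaves the
  third unchanged, since \<open>a\<close> is symmetric.\<close>

lemma christoffel_commute:
  assumes "riemannian_metric U a" "open U" "x \<in> U"
  shows "christoffel a i k n x = christoffel a i n k x"
proof -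
  have "a z $ k $ n = a z $ n $ k" if "z \<in> U" for z
  proof -
    have "transpose (a z) $ n $ k = a z $ n $ k"
      using assms(1) that by (simp add: riemannian_metric_def)
    then show ?thesis
      by (simp add: transpose_def)
  qed
  \<comment> \<open>Symmetry is known only on \<open>U\<close>; openness makes this enough for
    derivatives at \<open>x\<close>.\<close>
  then have "partial j (\<lambda>z. a z $ k $ n) x = partial j (\<lambda>z. a z $ n $ k) x" for j
    by (intro partial_cong_open[OF assms(2,3)])
  then show ?thesis
    unfolding christoffel_def by (simp add: add.commute)
qed

lemma smooth_on_imp_differentiable:
  "smooth_on S f \<Longrightarrow> x \<in> S \<Longrightarrow> f differentiable (at x)"
  unfolding smooth_on_def using C_on.simps(2) by blast

lemma smooth_on_imp_continuous_on:
  "smooth_on S f \<Longrightarrow> continuous_on S f"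
  unfolding smooth_on_def using C_on.simps(1) by blast

text \<open>By bilinearity g(v,v) = c A(Dv,Dv), so a nonzero kernel vector of \<open>D\<close> would
  contradict positivity of \<open>g\<close>.\<close>

lemma conformal_pullback_inj:
  fixes D :: "real ^ 'n \<Rightarrow> real ^ 'm"
  assumes pd: "positive_definite g"
    and g: "\<And>m n. g $ m $ n =
      c * (\<Sum>i\<in>UNIV. \<Sum>j\<in>UNIV. A $ i $ j * D (axis m 1) $ i * D (axis n 1) $ j)"
    and D: "linear D" and z: "D v = 0"
  shows "v = 0"
proof (rule ccontr)
  assume "v \<noteq> 0"
  have lin: "linear (\<lambda>v. D v $ i)" for i
    using linear_compose[OF D bounded_linear.linear[OF bounded_linear_vec_nth[of i]]]
    by (simp add: o_def)
  have D0: "(\<Sum>m\<in>UNIV. D (axis m 1) $ i * v $ m) = 0" for i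
    using linear_eq_sum_axis[OF lin, of v i] z by simp
  \<comment> \<open>Contracting the second index alone already produces the factor Dv = 0. The swaps
    below move the sum over \<open>n\<close> innermost so that \<open>D0\<close> applies.\<close>
  have "(\<Sum>n\<in>UNIV. g $ m $ n * v $ m * v $ n) = 0" for m
  proof -
    have "(\<Sum>n\<in>UNIV. g $ m $ n * v $ m * v $ n) = (\<Sum>n\<in>UNIV. \<Sum>i\<in>UNIV. \<Sum>j\<in>UNIV.
        c * v $ m * A $ i $ j * D (axis m 1) $ i * (D (axis n 1) $ j * v $ n))"
      by (simp add: g sum_distrib_left sum_distrib_right mult_ac)
    also have "\<dots> = (\<Sum>i\<in>UNIV. \<Sum>n\<in>UNIV. \<Sum>j\<in>UNIV.
        c * v $ m * A $ i $ j * D (axis m 1) $ i * (D (axis n 1) $ j * v $ n))"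
      by (rule sum.swap)
    also have "\<dots> = (\<Sum>i\<in>UNIV. \<Sum>j\<in>UNIV. \<Sum>n\<in>UNIV.
        c * v $ m * A $ i $ j * D (axis m 1) $ i * (D (axis n 1) $ j * v $ n))"
      by (rule sum.cong[OF refl sum.swap])
    also have "\<dots> = 0"
      by (simp add: D0 del: mult_eq_0_iff flip: sum_distrib_left)
    finally show ?thesis .
  qed
  then show False
    using pd \<open>v \<noteq> 0\<close> unfolding positive_definite_def by fastforce
qed

lemma has_derivative_slices:
  assumes "((\<lambda>(z, v). f z v) has_derivative D) (at (x, y))"
  shows "((\<lambda>z. f z y) has_derivative (\<lambda>u. D (u, 0))) (at x)"
    and "((\<lambda>v. f x v) has_derivative (\<lambda>v. D (0, v))) (at y)"
proof -
  have "((\<lambda>z. (z, y)) has_derivative (\<lambda>u. (u, 0))) (at x)"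
    and "((\<lambda>v. (x, v)) has_derivative (\<lambda>v. (0, v))) (at y)"
    by (auto intro: has_derivative_Pair has_derivative_ident has_derivative_const)
  from this[THEN has_derivative_compose, OF assms]
  show "((\<lambda>z. f z y) has_derivative (\<lambda>u. D (u, 0))) (at x)"
    and "((\<lambda>v. f x v) has_derivative (\<lambda>v. D (0, v))) (at y)"
    by simp_all
qed

text \<open>Carrying the base point along turns the family into one map \<open>\<Phi>\<close>
  between spaces of equal dimension. Its derivative is block triangular with identity base block, so
  injectivity on the fibre makes it invertible, and the inverse function theorem for a continuous
  map with a left inverse gives differentiability of \<open>\<Psi>\<close>, jointly in base point
  and vector.\<close>

lemma fibrewise_inverse_has_derivative:
  fixes T :: "'a::euclidean_space \<Rightarrow> 'b::euclidean_space \<Rightarrow> 'b"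
  assumes S: "open S" "(x, y) \<in> S"
    and cont: "continuous_on S (\<lambda>(z, v). T z v)"
    and D: "((\<lambda>(z, v). T z v) has_derivative D) (at (x, y))"
    and inj: "\<And>v. D (0, v) = 0 \<Longrightarrow> v = 0"
    and Y: "\<And>z v. (z, v) \<in> S \<Longrightarrow> Y z (T z v) = v"
  obtains E where "((\<lambda>(z, t). Y z t) has_derivative E) (at (x, T x y))"
proof -
  define \<Phi> where "\<Phi> = (\<lambda>w. (fst w, (\<lambda>(z, v). T z v) w))"
  define \<Psi> where "\<Psi> = (\<lambda>w. (fst w, (\<lambda>(z, t). Y z t) w))"
  define D' where "D' = (\<lambda>w. (fst w, D w))"
  have deriv: "(\<Phi> has_derivative D') (at (x, y))"
    unfolding \<Phi>_def D'_def
    by (intro has_derivative_Pair D has_derivative_fst has_derivative_ident)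
  then have lin: "linear D'"
    by (rule has_derivative_linear)
  have "inj D'"
    unfolding linear_injective_0[OF lin] using inj by (auto simp: D'_def zero_prod_def)
  \<comment> \<open>In finite dimension an injective endomorphism also has a right inverse.\<close>
  then obtain E' where E': "linear E'" "D' \<circ> E' = id"
    using linear_injective_isomorphism[OF lin] by (auto simp: fun_eq_iff)
  have "continuous_on S \<Phi>"
    unfolding \<Phi>_def by (intro continuous_on_Pair cont continuous_intros)
  moreover have "\<Psi> (\<Phi> w) = w" if "w \<in> S" for w
    using that Y by (cases w) (simp add: \<Phi>_def \<Psi>_def)
  ultimately have "(\<Psi> has_derivative E') (at (\<Phi> (x, y)))"
    using S deriv E'(2) by (intro has_derivative_inverse_strong[of S _ \<Phi>])
  then have "((\<lambda>w. snd (\<Psi> w)) has_derivative (\<lambda>w. snd (E' w))) (at (x, T x y))"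
    by (intro has_derivative_snd) (simp add: \<Phi>_def)
  then show ?thesis
    using that by (simp add: \<Psi>_def)
qed

theorem mainTheorem4:
  fixes U :: "(real ^ 'n) set"
    and F :: "real ^ 'n \<Rightarrow> real ^ 'n \<Rightarrow> real"
    and a :: "real ^ 'n \<Rightarrow> real ^ 'n ^ 'n"
    and H :: real
    and T Y :: "real ^ 'n \<Rightarrow> real ^ 'n \<Rightarrow> real ^ 'n"
    and n i :: 'n
    and x y :: "real ^ 'n"
  assumes "CARD('n) \<ge> 3"
    and "open U"
    and "finsler_metric U F"
    and "riemannian_metric U a"
    and "conformally_automorphic_via U F a H T"
    and "\<And>z v. z \<in> U \<Longrightarrow> v \<noteq> 0 \<Longrightarrow> Y z (T z v) = v"
    and "x \<in> U" and "y \<noteq> 0"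
  shows "connection_coeff a T Y n i x y = d_Riem a i (\<lambda>z t. Y z t $ n) x (T x y)
    \<and> d_Riem a i (\<lambda>z t. Y z t $ n) x (T x y)
        = partial i (\<lambda>z. Y z (T x y) $ n) x
          - (\<Sum>h\<in>UNIV. partial h (\<lambda>t. Y x t $ n) (T x y)
               * (\<Sum>k\<in>UNIV. christoffel a h i k x * T x y $ k))"
proof -
  have C: "smooth_on (U \<times> (- {0})) (\<lambda>(z, v). T z v)"
    and pd: "positive_definite (finsler_tensor F x y)"
    using assms unfolding conformally_automorphic_via_def finsler_metric_def by auto
  obtain p where p: "finsler_tensor F x y $ m $ n = (p x y)\<^sup>2 * (\<Sum>i\<in>UNIV. \<Sum>j\<in>UNIV.
      a x $ i $ j * partial m (\<lambda>v. T x v $ i) y * partial n (\<lambda>v. T x v $ j) y)" for m n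
    using assms(5,7,8) unfolding conformally_automorphic_via_def by blast
  have S: "open (U \<times> (- {0 :: real ^ 'n}))" "(x, y) \<in> U \<times> (- {0})"
    using assms by (auto intro: open_Times)
  obtain D where D: "((\<lambda>(z, v). T z v) has_derivative D) (at (x, y))"
    using smooth_on_imp_differentiable[OF C S(2)] unfolding differentiable_def by blast
  have Dy: "((\<lambda>v. T x v) has_derivative (\<lambda>v. D (0, v))) (at y)"
    using D by (rule has_derivative_slices)
  have Dx: "((\<lambda>z. T z y) has_derivative (\<lambda>u. D (u, 0))) (at x)"
    using D by (rule has_derivative_slices)
  have pT: "partial m (\<lambda>v. T x v $ i) y = D (0, axis m 1) $ i" for m i
    by (intro partial_eq_has_derivative bounded_linear.has_derivative[OF bounded_linear_vec_nth Dy])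
  \<comment> \<open>With \<open>pT\<close>, relation (iii) says that the Finsler tensor is the
    pullback of \<open>a\<close> under the fibre derivative, scaled by the square of
    \<open>p\<close>.\<close>
  have inj: "v = 0" if "D (0, v) = 0" for v
    using conformal_pullback_inj[OF pd p[unfolded pT] has_derivative_linear[OF Dy] that] .
  obtain E where E: "((\<lambda>(z, t). Y z t) has_derivative E) (at (x, T x y))"
    using fibrewise_inverse_has_derivative[OF S smooth_on_imp_continuous_on[OF C] D inj, of Y] assms(6)
    by auto
  have linE: "linear E"
    using E by (rule has_derivative_linear)
  have Et: "((\<lambda>t. Y x t) has_derivative (\<lambda>t. E (0, t))) (at (T x y))"
    using E by (rule has_derivative_slices)
  have Ex: "((\<lambda>z. Y z (T x y)) has_derivative (\<lambda>u. E (u, 0))) (at x)"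
    using E by (rule has_derivative_slices)
  have pYt: "partial h (\<lambda>t. Y x t $ n) (T x y) = E (0, axis h 1) $ n" for h
    by (intro partial_eq_has_derivative bounded_linear.has_derivative[OF bounded_linear_vec_nth Et])
  have pYx: "partial i (\<lambda>z. Y z (T x y) $ n) x = E (axis i 1, 0) $ n"
    by (intro partial_eq_has_derivative bounded_linear.has_derivative[OF bounded_linear_vec_nth Ex])
  have pTx: "partial i (\<lambda>z. T z y $ h) x = D (axis i 1, 0) $ h" for h
    by (intro partial_eq_has_derivative bounded_linear.has_derivative[OF bounded_linear_vec_nth Dx])

  have "((\<lambda>z. (z, T z y)) has_derivative (\<lambda>u. (u, D (u, 0)))) (at x)"
    by (intro has_derivative_Pair has_derivative_ident Dx)
  \<comment> \<open>Both arguments of \<open>Y\<close> move with \<open>z\<close>, so the joint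
    derivative \<open>E\<close> is required here. On \<open>U\<close> the composite is the constant
    \<open>y\<close>, hence this derivative vanishes.\<close>
  then have "((\<lambda>z. Y z (T z y)) has_derivative (\<lambda>u. E (u, D (u, 0)))) (at x)"
    using has_derivative_compose[where f = "\<lambda>z. (z, T z y)" and x = x, OF _ E] by simp
  then have "((\<lambda>z. y) has_derivative (\<lambda>u. E (u, D (u, 0)))) (at x)"
    by (rule has_derivative_transform_within_open[OF _ assms(2,7)]) (simp add: assms(6,8))
  then have "(\<lambda>u. E (u, D (u, 0))) = (\<lambda>u. 0)"
    by (rule has_derivative_unique[OF _ has_derivative_const])
  then have "E (axis i 1, D (axis i 1, 0)) = 0"
    by (rule fun_cong)
  \<comment> \<open>Linearity separates the derivative of \<open>Y\<close> at fixed t from the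
    contribution of the moving t(x,y).\<close>
  then have "E (axis i 1, 0) + E (0, D (axis i 1, 0)) = 0"
    using linear_add[OF linE, of "(axis i 1, 0)" "(0, D (axis i 1, 0))"] by simp
  then have "E (axis i 1, 0) $ n + E (0, D (axis i 1, 0)) $ n = 0"
    by (metis vector_add_component zero_index)
  moreover have "linear (\<lambda>t. E (0, t) $ n)"
    by (rule has_derivative_linear[OF bounded_linear.has_derivative[OF bounded_linear_vec_nth Et]])
  ultimately have chain: "partial i (\<lambda>z. Y z (T x y) $ n) x =
    - (\<Sum>h\<in>UNIV. partial h (\<lambda>t. Y x t $ n) (T x y) * partial i (\<lambda>z. T z y $ h) x)"
    unfolding pYx pYt pTx using linear_eq_sum_axis[of "\<lambda>t. E (0, t) $ n" "D (axis i 1, 0)"] by simp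

  have d_Riem: "d_Riem a i (\<lambda>z t. Y z t $ n) x (T x y)
        = partial i (\<lambda>z. Y z (T x y) $ n) x
          - (\<Sum>h\<in>UNIV. partial h (\<lambda>t. Y x t $ n) (T x y)
               * (\<Sum>k\<in>UNIV. christoffel a h i k x * T x y $ k))"
    unfolding d_Riem_def by (simp add: sum_distrib_left mult_ac)
  \<comment> \<open>\<open>chain\<close> accounts for the derivatives of \<open>T\<close> in the
    base point; symmetry of the Christoffel symbols aligns the lower indices, which the two
    definitions take in opposite order.\<close>
  moreover have "connection_coeff a T Y n i x y = \<dots>"
    unfolding chain connection_coeff_def christoffel_commute[OF assms(4,2,7), of _ i]
    by (simp add: distrib_left sum.distrib)
  ultimately show ?thesis
    by simp
qed

end
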